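(* For every integer $g\ge5$, every finite simple planar graph of girth at least $g$ is strongly $T(g)$-degenerate, where $$\alpha_g=\frac{g}{g-2},\qquad D_g=\lceil2\alpha_g\rceil-1,\qquad \rho_g=\max_{2\le r\le D_g}\frac{2^{r-1}-1}{1-\alpha_g/r}$$ (the maximum being over integers $r$), and, for integers $0\le q\le D_g$, $$C_g(q)=\left\lceil\rho_g\left(\alpha_g-\frac q2\right)\right\rceil,\qquad T(g)=\max_{0\le q\le D_g}\left(q+1+\left\lfloor\log_2 C_g(q)\right\rfloor\right).$$
   Context: All graphs are finite, simple and undirected. The girth of a graph is the length of a shortest cycle (infinite if the graph is acyclic). $N(u)$ denotes the set of neighbors of $u$. Strong degeneracy. Let $\prec$ be a total ordering of $V(G)$. For $u,v\in V(G)$ put $$N^-_\prec(u)=\{x\in N(u):x\prec u\},\quad N^+_\prec(u)=\{x\in N(u):u\prec x\},\quad N_{\prec u}(v)=\{x\in N(v):x\prec u\},$$ and $$\mathcal S_\prec(u)=\{Y\subseteq V(G): \text{there is } v\in N^+_\prec(u)\text{ with } Y\subseteq N_{\prec u}(v)\}.$$ The ordering $\prec$ is $t$-strong if, for every $u\in V(G)$, $|N^-_\prec(u)|+\log_2|\mathcal S_\prec(u)|<t$ when $N^+_\prec(u)\neq\emptyset$, and $|N^-_\prec(u)|\le t$ when $N^+_\prec(u)=\emptyset$. A graph is strongly $t$-degenerate if it has a $t$-strong ordering. *)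

theory Defs
  imports "HOL-Analysis.Analysis" "Graph_Theory.Graph_Theory"
begin

text \<open>
  A finite simple undirected graph is a \<open>pair_graph\<close> of the Graph_Theory library: a finite vertex
  set \<open>pverts G\<close> with a symmetric irreflexive adjacency relation \<open>parcs G\<close>. An undirected edge
  \<open>{u, v}\<close> is represented by both arcs \<open>(u, v)\<close> and \<open>(v, u)\<close>.
\<close>

definition nbhd :: "'a pair_pre_digraph \<Rightarrow> 'a \<Rightarrow> 'a set" where
  "nbhd G u = {x. (u, x) \<in> parcs G}"


section \<open>Girth and planarity\<close>

text \<open>
  The library's \<open>cycle\<close> is a directed notion, so in a symmetric digraph going back and forth along
  one edge is a cycle of length 2; requiring length at least 3 leaves exactly the cycles of the
  undirected graph. The infimum over the empty set is \<open>\<infinity>\<close>.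
\<close>

definition girth :: "'a pair_pre_digraph \<Rightarrow> enat" where
  "girth G = (INF c \<in> {c. pre_digraph.cycle (with_proj G) c \<and> 3 \<le> length c}. enat (length c))"

text \<open>
  The plane is \<^typ>\<open>complex\<close>, the type for which the library states the Jordan curve theorem.
  \<open>pos\<close> places the vertices; \<open>crv {u, v}\<close> draws the edge \<open>{u, v}\<close>, traversed in either direction.
\<close>

definition plane_drawing ::
    "'a pair_pre_digraph \<Rightarrow> ('a \<Rightarrow> complex) \<Rightarrow> ('a set \<Rightarrow> real \<Rightarrow> complex) \<Rightarrow> bool" where
  "plane_drawing G pos crv \<longleftrightarrow>
     inj_on pos (pverts G) \<and>
     (\<forall>(u, v) \<in> parcs G.
        arc (crv {u, v}) \<and>
        {pathstart (crv {u, v}), pathfinish (crv {u, v})} = {pos u, pos v} \<and>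
        path_image (crv {u, v}) \<inter> pos ` pverts G = {pos u, pos v}) \<and>
     (\<forall>(u, v) \<in> parcs G. \<forall>(x, y) \<in> parcs G. {u, v} \<noteq> {x, y} \<longrightarrow>
        path_image (crv {u, v}) \<inter> path_image (crv {x, y}) \<subseteq> pos ` ({u, v} \<inter> {x, y}))"

definition planar :: "'a pair_pre_digraph \<Rightarrow> bool" where
  "planar G \<longleftrightarrow> (\<exists>pos crv. plane_drawing G pos crv)"


section \<open>Strong degeneracy\<close>

text \<open>
  A total ordering of the vertices is given as its strict part \<open>r\<close>: \<open>(x, u) \<in> r\<close> means that \<open>x\<close>
  precedes \<open>u\<close>. \<open>nbhd_before G r u v\<close> consists of the neighbours of \<open>v\<close> preceding \<open>u\<close>.
\<close>

definition nbhd_less :: "'a pair_pre_digraph \<Rightarrow> 'a rel \<Rightarrow> 'a \<Rightarrow> 'a set" where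
  "nbhd_less G r u = {x \<in> nbhd G u. (x, u) \<in> r}"

definition nbhd_greater :: "'a pair_pre_digraph \<Rightarrow> 'a rel \<Rightarrow> 'a \<Rightarrow> 'a set" where
  "nbhd_greater G r u = {x \<in> nbhd G u. (u, x) \<in> r}"

definition nbhd_before :: "'a pair_pre_digraph \<Rightarrow> 'a rel \<Rightarrow> 'a \<Rightarrow> 'a \<Rightarrow> 'a set" where
  "nbhd_before G r u v = {x \<in> nbhd G v. (x, u) \<in> r}"

definition trace_sets :: "'a pair_pre_digraph \<Rightarrow> 'a rel \<Rightarrow> 'a \<Rightarrow> 'a set set" where
  "trace_sets G r u =
     {Y. Y \<subseteq> pverts G \<and> (\<exists>v \<in> nbhd_greater G r u. Y \<subseteq> nbhd_before G r u v)}"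

definition strong_ordering :: "int \<Rightarrow> 'a pair_pre_digraph \<Rightarrow> 'a rel \<Rightarrow> bool" where
  "strong_ordering t G r \<longleftrightarrow>
     strict_linear_order_on (pverts G) r \<and>
     (\<forall>u \<in> pverts G.
        (nbhd_greater G r u \<noteq> {} \<longrightarrow>
           real (card (nbhd_less G r u)) + log 2 (real (card (trace_sets G r u))) < of_int t) \<and>
        (nbhd_greater G r u = {} \<longrightarrow> int (card (nbhd_less G r u)) \<le> t))"

definition strongly_degenerate :: "int \<Rightarrow> 'a pair_pre_digraph \<Rightarrow> bool" where
  "strongly_degenerate t G \<longleftrightarrow> (\<exists>r. strong_ordering t G r)"


section \<open>The bound in terms of the girth\<close>

text \<open>
  The parameters are meant for \<open>g \<ge> 5\<close>. Then \<open>1 < alpha_of g < 2 \<le> D_of g < 2 * alpha_of g\<close>, so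
  the maxima below range over nonempty finite sets, no denominator vanishes, and \<open>C_of g q\<close> is
  positive.
\<close>

definition alpha_of :: "nat \<Rightarrow> real" where
  "alpha_of g = real g / (real g - 2)"

definition D_of :: "nat \<Rightarrow> int" where
  "D_of g = \<lceil>2 * alpha_of g\<rceil> - 1"

definition rho_of :: "nat \<Rightarrow> real" where
  "rho_of g = (MAX r \<in> {2..D_of g}. (2 ^ nat (r - 1) - 1) / (1 - alpha_of g / of_int r))"

definition C_of :: "nat \<Rightarrow> int \<Rightarrow> int" where
  "C_of g q = \<lceil>rho_of g * (alpha_of g - of_int q / 2)\<rceil>"

definition T_of :: "nat \<Rightarrow> int" where
  "T_of g = (MAX q \<in> {0..D_of g}. q + 1 + \<lfloor>log 2 (of_int (C_of g q))\<rfloor>)"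

end

theory Submission
  imports Defs
begin

text \<open>
  The proof has a topological half, which bounds the number of edges of a planar graph in terms of
  its girth, and a combinatorial half, which turns that bound into an ordering.

  \<^emph>\<open>Sparsity.\<close> A planar graph with $n \<ge> 1$ vertices, $e$ edges and girth at least $g$ satisfies
  $(g - 2) e \<le> g (n - 1)$ (\<open>girth_edge_bound\<close>), so $e < \<alpha>_g n$. A forest satisfies this because
  $e < n$. Otherwise let $f$ be the number of faces of a drawing, that is, of components of its
  complement. Starting from a maximal acyclic set of edges, every further edge closes a cycle and
  therefore, by the Jordan curve theorem, splits a face, so $f \<ge> e - n + 2$ (\<open>many_faces\<close>). The
  edges that meet the closure of a face contain a cycle, since the complement of a drawn forest is
  connected (\<open>face_touches_cycle\<close>); hence each face touches at least $g$ edges that lie on cycles.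
  Conversely, an edge on a cycle touches at most two faces (\<open>touching_faces_le_2\<close>), by
  Janiszewski's theorem applied to that cycle and the rest of the drawing. Counting incidences
  gives $g f \<le> 2 e$, and with $f \<ge> e - n + 2$ the bound follows.

  \<^emph>\<open>The ordering.\<close> It is built from its last element to its first. Let $W$ be the set of vertices not
  yet placed, and suppose that every placed vertex $v$ has $r_v \<le> D_g$ neighbours in $W$. If
  $u \<in> W$ is placed next, then it has $q = \<bar>N(u) \<inter> W\<bar>$ earlier neighbours, and each later neighbour
  $v$ contributes at most $2^{r_v - 1} - 1$ nonempty sets to $\<S>(u)$. Sparsity of the subgraph formed
  by the edges within $W$ and the edges from $W$ to the placed vertices with $r_v \<ge> 2$ gives
  \[ e(W) + \<Sum>_v (r_v - \<alpha>_g) < \<alpha>_g \<bar>W\<bar>. \]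
  The number $\<rho>_g$ is chosen so that $r_v (2^{r_v - 1} - 1) / \<rho>_g \<le> r_v - \<alpha>_g$. Distributing each
  $v$ evenly among its neighbours in $W$ and averaging yields $u \<in> W$ with
  $q / 2 + s / \<rho>_g < \<alpha>_g$, where $s$ is the sum of the $2^{r_v - 1} - 1$ over the later neighbours
  $v$ of $u$ (\<open>exists_light_vertex\<close>). Then $q \<le> D_g$, which preserves the assumption on $W$, and
  $s + 1 \<le> C_g(q)$, which bounds $\<bar>\<S>(u)\<bar>$ as $T(g)$ requires.
\<close>

(* The graph library has a connectedness predicate of the same name; here it is topological. *)
hide_const (open) Digraph_Component.connected


section \<open>Cycles and forests as edge sets\<close>

fun walk_edges :: "'a list \<Rightarrow> 'a set set" where
  "walk_edges (x # y # xs) = insert {x, y} (walk_edges (y # xs))"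
| "walk_edges _ = {}"

definition cycle_edges :: "'a list \<Rightarrow> 'a set set" where
  "cycle_edges vs = insert {last vs, hd vs} (walk_edges vs)"

text \<open>
  Vertex lists up to rotation and reversal are the cycles; with fewer than three vertices the list
  would run back and forth along a single edge.
\<close>
definition cycle_in :: "'a set set \<Rightarrow> 'a list \<Rightarrow> bool" where
  "cycle_in E vs \<longleftrightarrow> distinct vs \<and> 3 \<le> length vs \<and> cycle_edges vs \<subseteq> E"

lemma walk_edges_Cons:
  "walk_edges (x # xs) = (if xs = [] then {} else insert {x, hd xs} (walk_edges xs))"
  by (cases xs) auto

lemma walk_edges_append:
  assumes "xs \<noteq> []" "ys \<noteq> []"
  shows "walk_edges (xs @ ys) = insert {last xs, hd ys} (walk_edges xs \<union> walk_edges ys)"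
  using assms by (induction xs) (auto simp: walk_edges_Cons)

lemma finite_walk_edges [simp]: "finite (walk_edges vs)"
  by (induction vs) (auto simp: walk_edges_Cons)

lemma walk_edges_subset: "e \<in> walk_edges vs \<Longrightarrow> e \<subseteq> set vs"
  by (induction vs) (auto simp: walk_edges_Cons split: if_splits)

lemma walk_vertices: "2 \<le> length vs \<Longrightarrow> set vs \<subseteq> \<Union>(walk_edges vs)"
proof (induction vs)
  case (Cons y ys)
  then show ?case by (cases ys; cases "tl ys") auto
qed simp

lemma closing_edge_notin_walk_edges:
  assumes "distinct vs" "3 \<le> length vs"
  shows "{last vs, hd vs} \<notin> walk_edges vs"
proof -
  obtain x y z zs where vs: "vs = x # y # z # zs"
    using assms(2) by (auto simp: numeral_3_eq_3 Suc_le_length_iff)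
  have "last (z # zs) \<in> set (z # zs)"
    by (rule last_in_set) simp
  with assms vs show ?thesis
    using walk_edges_subset[of "{last vs, x}" "y # z # zs"]
    by (auto simp: doubleton_eq_iff)
qed

lemma card_walk_edges: "distinct vs \<Longrightarrow> card (walk_edges vs) = length vs - 1"
proof (induction vs)
  case (Cons x xs)
  have "{x, hd xs} \<notin> walk_edges xs"
    using walk_edges_subset[of "{x, hd xs}" xs] Cons.prems by auto
  with Cons show ?case
    by (cases xs) (auto simp: walk_edges_Cons)
qed simp

lemma card_cycle_edges:
  assumes "distinct vs" "3 \<le> length vs"
  shows "card (cycle_edges vs) = length vs"
  using closing_edge_notin_walk_edges[OF assms] card_walk_edges[OF assms(1)] assms(2)
  by (simp add: cycle_edges_def)

lemma walk_edges_split: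
  "e \<in> walk_edges vs \<Longrightarrow> \<exists>xs ys. vs = xs @ ys \<and> xs \<noteq> [] \<and> ys \<noteq> [] \<and> e = {last xs, hd ys}"
proof (induction vs)
  case (Cons x vs)
  then consider "vs \<noteq> []" "e = {x, hd vs}" | "e \<in> walk_edges vs"
    by (auto simp: walk_edges_Cons split: if_splits)
  then show ?case
  proof cases
    case 1
    then show ?thesis by (intro exI[of _ "[x]"] exI[of _ vs]) auto
  next
    case 2
    with Cons.IH obtain xs ys where "vs = xs @ ys" "xs \<noteq> []" "ys \<noteq> []" "e = {last xs, hd ys}"
      by blast
    then show ?thesis by (intro exI[of _ "x # xs"] exI[of _ ys]) auto
  qed
qed simp

text \<open>
  Rotating the list turns any chosen edge of a cycle into the closing edge, so that the rest of the
  cycle is a path between the two ends of that edge.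
\<close>
lemma cycle_in_rotate:
  assumes "cycle_in E vs" "e \<in> cycle_edges vs"
  obtains ws where "cycle_in E ws" "e = {last ws, hd ws}"
proof (cases "e \<in> walk_edges vs")
  case True
  then obtain xs ys where *: "vs = xs @ ys" "xs \<noteq> []" "ys \<noteq> []" "e = {last xs, hd ys}"
    using walk_edges_split by blast
  have "cycle_edges (ys @ xs) = cycle_edges (xs @ ys)"
    using *(2,3) by (auto simp: cycle_edges_def walk_edges_append)
  with assms(1) * have "cycle_in E (ys @ xs)"
    by (auto simp: cycle_in_def)
  then show thesis using that[of "ys @ xs"] * by simp
next
  case False
  then show thesis using assms that by (auto simp: cycle_edges_def)
qed

text \<open>
  The first vertex $v$ of a longest path is a leaf: a second edge at $v$ would either prolong the path
  or lead back into it and close a cycle.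
\<close>
lemma acyclic_leaf:
  assumes "finite E" "\<And>e. e \<in> E \<Longrightarrow> card e = 2" "E \<noteq> {}" "\<nexists>vs. cycle_in E vs"
  obtains u v where "u \<noteq> v" "{u, v} \<in> E" "\<And>e. e \<in> E \<Longrightarrow> v \<in> e \<Longrightarrow> e = {u, v}"
proof -
  \<comment> \<open>The lists satisfying \<open>P\<close> are the paths with at least one edge.\<close>
  define P where "P vs \<longleftrightarrow> distinct vs \<and> 2 \<le> length vs \<and> walk_edges vs \<subseteq> E" for vs
  have fin: "finite (\<Union>E)"
    using assms(1,2) by (metis card.infinite finite_Union zero_neq_numeral)
  have bound: "length vs \<le> card (\<Union>E)" if "P vs" for vs
  proof -
    have "set vs \<subseteq> \<Union>(walk_edges vs)"
      using \<open>P vs\<close> walk_vertices[of vs] by (auto simp: P_def)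
    then have "set vs \<subseteq> \<Union>E" using \<open>P vs\<close> unfolding P_def by blast
    then show ?thesis
      using \<open>P vs\<close> card_mono[OF fin, of "set vs"] distinct_card[of vs] by (simp add: P_def)
  qed
  obtain e where "e \<in> E" using assms(3) by blast
  then obtain a b where "a \<noteq> b" "{a, b} \<in> E" using assms(2) by (metis card_2_iff)
  then have "P [a, b]" by (simp add: P_def)
  then obtain vs where vs: "P vs" and max: "\<And>ws. P ws \<Longrightarrow> length ws \<le> length vs"
    using ex_has_greatest_nat[of P "[a, b]" length "card (\<Union>E) + 1"] bound
    by (auto simp: le_less_Suc_eq less_Suc_eq_le)
  then obtain v u ws where [simp]: "vs = v # u # ws"
    unfolding P_def by (metis Suc_le_length_iff numeral_2_eq_2)
  have "e = {u, v}" if "e \<in> E" "v \<in> e" for e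
  proof (rule ccontr)
    assume "e \<noteq> {u, v}"
    obtain w where w: "e = {v, w}" "w \<noteq> v"
      using assms(2)[OF \<open>e \<in> E\<close>] \<open>v \<in> e\<close> by (auto simp: card_2_iff)
    with \<open>e \<noteq> {u, v}\<close> have "w \<noteq> u" by auto
    show False
    proof (cases "w \<in> set vs")
      case False
      then have "P (w # vs)"
        using vs w \<open>e \<in> E\<close> by (auto simp: P_def insert_commute)
      with max show False by fastforce
    next
      case True
      with w(2) \<open>w \<noteq> u\<close> obtain as bs where [simp]: "ws = as @ w # bs"
        by (auto simp: in_set_conv_decomp)
      have "walk_edges vs = walk_edges ((v # u # as @ [w]) @ bs)" by simp
      then have "walk_edges (v # u # as @ [w]) \<subseteq> walk_edges vs"
        by (cases "bs = []") (auto simp: walk_edges_append simp del: append.simps walk_edges.simps)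
      then have "cycle_in E (v # u # as @ [w])"
        using vs w \<open>e \<in> E\<close> unfolding P_def cycle_in_def cycle_edges_def
        by (auto simp: insert_commute)
      with assms(4) show False by blast
    qed
  qed
  moreover have "u \<noteq> v" "{u, v} \<in> E" using vs by (auto simp: P_def insert_commute)
  ultimately show thesis using that by blast
qed

lemma cycle_in_mono: "cycle_in E vs \<Longrightarrow> E \<subseteq> E' \<Longrightarrow> cycle_in E' vs"
  by (auto simp: cycle_in_def)

text \<open>
  Repeatedly removing leaves shows that every forest arises from the empty one by attaching new
  leaves; this form also serves to glue drawn edges one at a time.
\<close>
lemma acyclic_induct:
  assumes "finite E" "\<And>e. e \<in> E \<Longrightarrow> card e = 2" "\<nexists>vs. cycle_in E vs"
    and empty: "P {}"
    and leaf: "\<And>E u v. finite E \<Longrightarrow> u \<noteq> v \<Longrightarrow> v \<notin> \<Union>E \<Longrightarrow> P E \<Longrightarrow> P (insert {u, v} E)"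
  shows "P E"
  using assms(1-3)
proof (induction E rule: finite_psubset_induct)
  case (psubset E)
  show ?case
  proof (cases "E = {}")
    case False
    then obtain u v where uv: "u \<noteq> v" "{u, v} \<in> E" "\<And>e. e \<in> E \<Longrightarrow> v \<in> e \<Longrightarrow> e = {u, v}"
      using acyclic_leaf[of E] psubset by metis
    have "P (E - {{u, v}})"
      using uv(2) psubset.prems cycle_in_mono[of "E - {{u, v}}" _ E] by (intro psubset.IH) blast+
    moreover have "v \<notin> \<Union>(E - {{u, v}})" using uv(3) by blast
    ultimately show ?thesis
      using leaf[of "E - {{u, v}}" u v] uv(1,2) psubset.hyps by (simp add: insert_absorb)
  qed (simp add: empty)
qed

lemma acyclic_card:
  assumes "finite V" "V \<noteq> {}" "\<Union>E \<subseteq> V" "\<And>e. e \<in> E \<Longrightarrow> card e = 2" "\<nexists>vs. cycle_in E vs"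
  shows "card E < card V"
proof -
  have "finite E" using assms(1,3) by (meson finite_UnionD finite_subset)
  have "\<forall>V. finite V \<and> V \<noteq> {} \<and> \<Union>E \<subseteq> V \<longrightarrow> card E < card V"
  proof (rule acyclic_induct[OF \<open>finite E\<close> assms(4,5)])
    fix E :: "'a set set" and u v
    assume E: "finite E" "u \<noteq> v" "v \<notin> \<Union>E"
      and IH: "\<forall>V. finite V \<and> V \<noteq> {} \<and> \<Union>E \<subseteq> V \<longrightarrow> card E < card V"
    show "\<forall>V. finite V \<and> V \<noteq> {} \<and> \<Union>(insert {u, v} E) \<subseteq> V \<longrightarrow> card (insert {u, v} E) < card V"
    proof (intro allI impI, elim conjE)
      fix V :: "'a set" assume V: "finite V" "\<Union>(insert {u, v} E) \<subseteq> V"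
      have "u \<in> V - {v}" "\<Union>E \<subseteq> V - {v}" "v \<in> V" using V(2) E by auto
      then have "card E < card (V - {v})"
        using IH V(1) by (metis empty_iff finite_Diff)
      then show "card (insert {u, v} E) < card V"
        using V(1) E(1) \<open>v \<in> V\<close> by (auto simp: card_insert_if)
    qed
  qed (auto simp: card_gt_0_iff)
  with assms show ?thesis by blast
qed


section \<open>Faces of plane graphs\<close>

text \<open>
  Edge sets rather than digraphs make it easy to pass to the subgraphs that the counting argument
  needs.
\<close>
locale plane_graph =
  fixes V :: "'a set" and E :: "'a set set" and pos :: "'a \<Rightarrow> complex"
    and crv :: "'a set \<Rightarrow> real \<Rightarrow> complex"
  assumes finite_V: "finite V"
    and edge_subset: "e \<in> E \<Longrightarrow> e \<subseteq> V"
    and card_edge: "e \<in> E \<Longrightarrow> card e = 2"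
    and inj_pos: "inj_on pos V"
    and arc_crv: "e \<in> E \<Longrightarrow> arc (crv e)"
    and crv_ends: "e \<in> E \<Longrightarrow> {pathstart (crv e), pathfinish (crv e)} = pos ` e"
    and crv_vertices: "e \<in> E \<Longrightarrow> path_image (crv e) \<inter> pos ` V = pos ` e"
    and crv_disjoint: "e \<in> E \<Longrightarrow> f \<in> E \<Longrightarrow> e \<noteq> f \<Longrightarrow>
      path_image (crv e) \<inter> path_image (crv f) \<subseteq> pos ` (e \<inter> f)"
begin

abbreviation img :: "'a set \<Rightarrow> complex set" where
  "img e \<equiv> path_image (crv e)"

text \<open>
  An edge without its ends: it avoids all vertices and all other edges.
\<close>
definition open_edge :: "'a set \<Rightarrow> complex set" where
  "open_edge e = img e - pos ` e"

text \<open>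
  All vertices are kept, whichever edges are drawn, so that the drawings of different edge sets differ
  only in open edges.
\<close>
definition drawn :: "'a set set \<Rightarrow> complex set" where
  "drawn B = (\<Union>e\<in>B. img e) \<union> pos ` V"

definition touches :: "complex set \<Rightarrow> 'a set \<Rightarrow> bool" where
  "touches F e \<longleftrightarrow> closure F \<inter> open_edge e \<noteq> {}"

lemma finite_E: "finite E"
  using finite_V edge_subset by (meson PowI finite_Pow_iff finite_subset subsetI)

lemma ends_in_img: "e \<in> E \<Longrightarrow> pos ` e \<subseteq> img e"
  using crv_ends[of e] pathstart_in_path_image[of "crv e"] pathfinish_in_path_image[of "crv e"]
  by (simp flip: crv_ends)

lemma compact_drawn: "B \<subseteq> E \<Longrightarrow> compact (drawn B)"
  unfolding drawn_def using finite_E finite_V arc_crv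
  by (intro compact_Un compact_UN compact_arc_image finite_imp_compact)
    (auto intro: finite_subset)

lemma img_Int_drawn:
  assumes "e \<in> E" "B \<subseteq> E" "e \<notin> B"
  shows "img e \<inter> drawn B = pos ` e"
proof
  have "img e \<inter> img f \<subseteq> pos ` e" if "f \<in> B" for f
    using crv_disjoint[of e f] that assms by blast
  then show "img e \<inter> drawn B \<subseteq> pos ` e"
    using crv_vertices[OF assms(1)] by (auto simp: drawn_def)
  show "pos ` e \<subseteq> img e \<inter> drawn B"
    using ends_in_img[OF assms(1)] edge_subset[OF assms(1)] by (auto simp: drawn_def)
qed

lemma open_edge_endless:
  assumes "e \<in> E"
  shows "connected (open_edge e)" "open_edge e \<noteq> {}"
  using connected_simple_path_endless[OF arc_imp_simple_path[OF arc_crv[OF assms]]]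
    nonempty_simple_path_endless[OF arc_imp_simple_path[OF arc_crv[OF assms]]]
  by (simp_all add: open_edge_def crv_ends[OF assms])

text \<open>
  An arc does not separate the plane. Attaching a leaf edge to a forest adds an arc that meets what is
  already drawn in at most one point, so Janiszewski's theorem keeps the complement connected. Removing
  the finitely many remaining vertices from an open connected set does no harm.
\<close>
lemma connected_Compl_drawn_acyclic:
  assumes "B \<subseteq> E" "\<nexists>vs. cycle_in B vs"
  shows "connected (- drawn B)"
proof -
  have "finite B" using assms(1) finite_E finite_subset by blast
  moreover have "card e = 2" if "e \<in> B" for e using that assms(1) card_edge by blast
  ultimately have "B \<subseteq> E \<longrightarrow> connected (- (\<Union>e\<in>B. img e))"
    using assms(2)
  proof (rule acyclic_induct)
    fix B and u v :: 'a
    let ?e = "{u, v}" and ?S = "\<Union>e\<in>B. img e"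
    assume B: "finite B" "v \<notin> \<Union>B" and IH: "B \<subseteq> E \<longrightarrow> connected (- ?S)"
    show "insert ?e B \<subseteq> E \<longrightarrow> connected (- (\<Union>e\<in>insert ?e B. img e))"
    proof
      assume sub: "insert ?e B \<subseteq> E"
      have "?S \<inter> img ?e \<subseteq> pos ` {u}"
      proof
        fix x assume "x \<in> ?S \<inter> img ?e"
        then obtain f where f: "f \<in> B" "x \<in> img ?e \<inter> img f" by blast
        then have "x \<in> pos ` (?e \<inter> f)" using crv_disjoint[of ?e f] B(2) sub by blast
        then show "x \<in> pos ` {u}" using f(1) B(2) by auto
      qed
      then have "connected (?S \<inter> img ?e)"
        by (auto dest!: subset_singletonD)
      moreover have "compact ?S" using sub B(1) by (intro compact_UN compact_arc_image arc_crv) auto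
      moreover have "closed (img ?e)" using sub by (intro closed_arc_image arc_crv) auto
      moreover have "connected (- img ?e)" using sub by (intro connected_arc_complement arc_crv) auto
      ultimately have "connected (- (?S \<union> img ?e))"
        using IH sub by (intro Janiszewski_connected) auto
      then show "connected (- (\<Union>e\<in>insert ?e B. img e))" by (simp add: Un_commute)
    qed
  qed (auto intro: connected_UNIV)
  then have "connected (- (\<Union>e\<in>B. img e))" using assms(1) by blast
  moreover have "closed (\<Union>e\<in>B. img e)"
    using assms(1) \<open>finite B\<close> by (intro closed_UN ballI closed_arc_image arc_crv) auto
  ultimately have "connected (- (\<Union>e\<in>B. img e) - pos ` V)"
    using finite_V by (intro connected_open_delete_finite) (auto intro: open_Compl simp del: Compl_UN)
  then show ?thesis by (simp add: drawn_def Compl_Un Diff_eq)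
qed

lemma oriented_edge:
  assumes "{x, y} \<in> E"
  obtains q where "arc q" "pathstart q = pos x" "pathfinish q = pos y" "path_image q = img {x, y}"
proof -
  have "{pathstart (crv {x, y}), pathfinish (crv {x, y})} = {pos x, pos y}"
    using crv_ends[OF assms] by simp
  then consider "pathstart (crv {x, y}) = pos x" "pathfinish (crv {x, y}) = pos y"
    | "pathstart (crv {x, y}) = pos y" "pathfinish (crv {x, y}) = pos x"
    by (auto simp: doubleton_eq_iff)
  then show thesis
    using that[of "crv {x, y}"] that[of "reversepath (crv {x, y})"] arc_crv[OF assms]
    by cases (auto simp: arc_reversepath)
qed

lemma walk_arc:
  assumes "distinct vs" "2 \<le> length vs" "walk_edges vs \<subseteq> E"
  shows "\<exists>p. arc p \<and> pathstart p = pos (hd vs) \<and> pathfinish p = pos (last vs) \<and>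
    path_image p = (\<Union>e\<in>walk_edges vs. img e)"
  using assms
proof (induction vs)
  case (Cons x vs)
  then obtain y ys where [simp]: "vs = y # ys" by (cases vs) auto
  from Cons.prems(3) obtain q where q: "arc q" "pathstart q = pos x" "pathfinish q = pos y"
      "path_image q = img {x, y}"
    using oriented_edge[of x y] by auto
  show ?case
  proof (cases "ys = []")
    case True
    with q show ?thesis by auto
  next
    case False
    then have "2 \<le> length vs" by (cases ys) auto
    with Cons obtain p where p: "arc p" "pathstart p = pos y" "pathfinish p = pos (last vs)"
        "path_image p = (\<Union>e\<in>walk_edges vs. img e)"
      by auto
    have "path_image q \<inter> path_image p \<subseteq> {pathstart p}"
    proof
      fix z assume "z \<in> path_image q \<inter> path_image p"
      then obtain f where f: "f \<in> walk_edges vs" "z \<in> img {x, y} \<inter> img f"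
        using q(4) p(4) by auto
      have "x \<notin> f" using walk_edges_subset[OF f(1)] Cons.prems(1) by auto
      moreover from this have "z \<in> pos ` ({x, y} \<inter> f)"
        using crv_disjoint[of "{x, y}" f] f Cons.prems(3) by (auto simp: subset_iff)
      ultimately show "z \<in> {pathstart p}" using p(2) by auto
    qed
    then have "arc (q +++ p)" using q p by (intro arc_join) auto
    moreover have "path_image (q +++ p) = (\<Union>e\<in>walk_edges (x # vs). img e)"
      using q p by (simp add: path_image_join)
    ultimately show ?thesis using q p by (intro exI[of _ "q +++ p"]) auto
  qed
qed simp

text \<open>
  A cycle through \<open>e\<close> is drawn as a simple closed curve. The part \<open>P\<close> other than \<open>e\<close> is named
  separately because it is what the curve has in common with the drawing of the remaining edges.
\<close>
lemma cycle_curve: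
  assumes "cycle_in E vs" and e: "e = {last vs, hd vs}"
  obtains c P where "simple_path c" "pathfinish c = pathstart c" "path_image c = P \<union> img e"
    "P = (\<Union>f\<in>walk_edges vs. img f)" "connected P" "pos ` e \<subseteq> P" "e \<notin> walk_edges vs" "e \<in> E"
proof -
  have vs: "distinct vs" "3 \<le> length vs" "walk_edges vs \<subseteq> E" "e \<in> E"
    using assms by (auto simp: cycle_in_def cycle_edges_def)
  then obtain p where p: "arc p" "pathstart p = pos (hd vs)" "pathfinish p = pos (last vs)"
      "path_image p = (\<Union>e\<in>walk_edges vs. img e)"
    using walk_arc[of vs] by auto
  from vs(4) obtain q where q: "arc q" "pathstart q = pos (last vs)" "pathfinish q = pos (hd vs)"
      "path_image q = img e"
    unfolding e by (rule oriented_edge)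
  have e_notin: "e \<notin> walk_edges vs"
    using closing_edge_notin_walk_edges[OF vs(1,2)] e by simp
  have "path_image p \<inter> path_image q \<subseteq> {pathstart p, pathstart q}"
  proof
    fix z assume "z \<in> path_image p \<inter> path_image q"
    then obtain f where f: "f \<in> walk_edges vs" "z \<in> img e \<inter> img f"
      using q(4) p(4) by auto
    with e_notin have "z \<in> pos ` (e \<inter> f)" using crv_disjoint[of e f] vs(3,4) by blast
    then show "z \<in> {pathstart p, pathstart q}" using p q e by auto
  qed
  then have "simple_path (p +++ q)" using p q by (intro simple_path_join_loop) auto
  moreover have "path_image (p +++ q) = path_image p \<union> img e"
    using p q by (simp add: path_image_join)
  moreover have "connected (path_image p)" using p(1) by (simp add: arc_imp_path connected_path_image)
  moreover have "pos ` e \<subseteq> path_image p"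
    using pathstart_in_path_image[of p] pathfinish_in_path_image[of p] p(2,3) e by auto
  ultimately show thesis
    using that[of "p +++ q" "path_image p"] p q e_notin vs(4) by auto
qed

lemma connected_Un_touching:
  assumes "connected F" "connected K" "closure F \<inter> K \<noteq> {}"
  shows "connected (F \<union> K)"
proof -
  from assms(3) obtain z where z: "z \<in> closure F" "z \<in> K" by blast
  have "connected (insert z F)"
    by (rule connected_intermediate_closure[OF assms(1)]) (use z closure_subset in auto)
  then have "connected (insert z F \<union> K)"
    using assms(2) z by (intro connected_Un) auto
  moreover have "insert z F \<union> K = F \<union> K" using z by blast
  ultimately show ?thesis by simp
qed

text \<open>
  Let $C$ be the closed curve of a cycle through $e$ and $S$ the drawing without $e$. Two faces that
  both touch $e$ are joined outside $S$, along the open edge $e$. If they lie on the same side of $C$,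
  then they are also joined outside $C$. As $S \<inter> C$ is the connected arc complementary to $e$ in $C$,
  Janiszewski's theorem joins them outside $S \<union> C$, the whole drawing, and they coincide. So there is
  at most one such face on each of the two sides of $C$.
\<close>
lemma touching_faces_le_2:
  assumes cyc: "cycle_in E vs" "e \<in> cycle_edges vs"
    and A: "finite A" "A \<subseteq> components (- drawn E)" "\<And>F. F \<in> A \<Longrightarrow> touches F e"
  shows "card A \<le> 2"
proof -
  obtain ws where ws: "cycle_in E ws" "e = {last ws, hd ws}"
    using cycle_in_rotate[OF cyc] .
  obtain c P where c: "simple_path c" "pathfinish c = pathstart c" "path_image c = P \<union> img e"
    and P: "P = (\<Union>f\<in>walk_edges ws. img f)" "connected P" "pos ` e \<subseteq> P"
    and e: "e \<notin> walk_edges ws" "e \<in> E"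
    using cycle_curve[OF ws] .
  let ?C = "path_image c" and ?S = "drawn (E - {e})"
  have J: "open (inside ?C)" "open (outside ?C)" "connected (inside ?C)" "connected (outside ?C)"
    "inside ?C \<inter> outside ?C = {}" "inside ?C \<union> outside ?C = - ?C"
    "frontier (inside ?C) = ?C" "frontier (outside ?C) = ?C"
    using Jordan_inside_outside[OF c(1,2)] by blast+
  have walk: "walk_edges ws \<subseteq> E - {e}"
    using ws e by (auto simp: cycle_in_def cycle_edges_def)
  have SC: "?S \<inter> ?C = P"
  proof -
    have "P \<subseteq> ?S" using P(1) walk by (auto simp: drawn_def)
    moreover have "img e \<inter> ?S = pos ` e" using img_Int_drawn[OF e(2)] by simp
    ultimately show ?thesis using P(3) unfolding c(3) by blast
  qed
  have SC_Un: "?S \<union> ?C = drawn E"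
    using P(1) walk e(2) unfolding c(3) drawn_def by auto
  have side: "F \<subseteq> inside ?C \<or> F \<subseteq> outside ?C" if "F \<in> components (- drawn E)" for F
  proof -
    have "F \<subseteq> inside ?C \<union> outside ?C"
      using in_components_subset[OF that] J(6) SC_Un by blast
    moreover have "inside ?C \<inter> F = {} \<or> outside ?C \<inter> F = {}"
      using connectedD[OF in_components_connected[OF that] J(1,2)] calculation J(5) by blast
    ultimately show ?thesis by blast
  qed
  define h where "h F = (F \<subseteq> inside ?C)" for F
  have "inj_on h A"
  proof (rule inj_onI)
    fix F G assume FG: "F \<in> A" "G \<in> A" "h F = h G"
    then have comp: "F \<in> components (- drawn E)" "G \<in> components (- drawn E)" using A by auto
    then obtain a b where ab: "a \<in> F" "b \<in> G" using in_components_nonempty by blast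
    have "connected_component (- ?C) a b"
    proof (cases "h F")
      case True
      then show ?thesis
        using ab J(3,6) FG(3) unfolding h_def connected_component_def
        by (intro exI[of _ "inside ?C"]) blast
    next
      case False
      then show ?thesis
        using ab J(4,6) FG(3) side[OF comp(1)] side[OF comp(2)] unfolding h_def connected_component_def
        by (intro exI[of _ "outside ?C"]) blast
    qed
    moreover have "connected_component (- ?S) a b"
    proof -
      have "connected (F \<union> open_edge e)" "connected (G \<union> open_edge e)"
        using A(3) FG(1,2) open_edge_endless[OF e(2)] in_components_connected comp
        by (auto intro!: connected_Un_touching simp: touches_def)
      then have "connected ((F \<union> open_edge e) \<union> (G \<union> open_edge e))"
        by (rule connected_Un) (use open_edge_endless(2)[OF e(2)] in blast)
      moreover have "open_edge e \<subseteq> - ?S"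
        using img_Int_drawn[OF e(2), of "E - {e}"] unfolding open_edge_def by blast
      moreover have "F \<subseteq> - ?S" "G \<subseteq> - ?S"
        using comp in_components_subset SC_Un by blast+
      ultimately show ?thesis
        using ab unfolding connected_component_def
        by (intro exI[of _ "(F \<union> open_edge e) \<union> (G \<union> open_edge e)"]) blast
    qed
    ultimately have "connected_component (- (?S \<union> ?C)) a b"
      using SC P(2) c(1) compact_drawn[of "E - {e}"]
      by (intro Janiszewski) (auto intro: closed_simple_path_image)
    then obtain T where "connected T" "T \<subseteq> - drawn E" "a \<in> T" "b \<in> T"
      unfolding SC_Un connected_component_def by blast
    then show "F = G" using joinable_components_eq[of T "- drawn E" F G] comp ab by blast
  qed
  then have "card A \<le> card (UNIV :: bool set)"
    by (intro card_inj_on_le[of h]) auto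
  then show ?thesis by simp
qed

text \<open>
  The open edge $e$ lies in one face $F_0$ of the old drawing, and all other faces survive. The closed
  curve through $e$ has its inside and its outside near every point of $e$, hence both of them meet
  $F_0$; they give two new faces within $F_0$.
\<close>
lemma add_closing_edge:
  assumes B: "B \<subseteq> E" and cyc: "cycle_in (insert e B) vs" "e = {last vs, hd vs}"
    and e: "e \<in> E" "e \<notin> B"
    and A: "finite A" "A \<subseteq> components (- drawn B)"
  obtains A' where "finite A'" "A' \<subseteq> components (- drawn (insert e B))" "card A < card A'"
proof -
  have "cycle_in E vs" using cycle_in_mono[OF cyc(1)] B e by blast
  then obtain c P where c: "simple_path c" "pathfinish c = pathstart c" "path_image c = P \<union> img e"
    and P: "P = (\<Union>f\<in>walk_edges vs. img f)" "e \<notin> walk_edges vs"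
    using cycle_curve[OF _ cyc(2)] by metis
  let ?C = "path_image c" and ?S = "drawn B" and ?X = "drawn (insert e B)"
  have J: "open (inside ?C)" "open (outside ?C)" "connected (inside ?C)" "connected (outside ?C)"
    "inside ?C \<inter> outside ?C = {}" "inside ?C \<union> outside ?C = - ?C"
    "frontier (inside ?C) = ?C" "frontier (outside ?C) = ?C"
    using Jordan_inside_outside[OF c(1,2)] by blast+
  have X: "?X = ?S \<union> img e" by (auto simp: drawn_def)
  have CX: "?C \<subseteq> ?X"
    using cyc P c(3) unfolding drawn_def cycle_in_def cycle_edges_def by auto
  have open_edge: "open_edge e \<inter> ?S = {}"
    using img_Int_drawn[OF e(1) B e(2)] unfolding open_edge_def by blast
  obtain z where z: "z \<in> open_edge e" using open_edge_endless[OF e(1)] by blast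
  define F0 where "F0 = connected_component_set (- ?S) z"
  have "open (- ?S)" using compact_drawn[OF B] by (simp add: compact_imp_closed open_Compl)
  then have F0: "F0 \<in> components (- ?S)" "open F0" "z \<in> F0"
    using z open_edge unfolding F0_def
    by (auto intro: open_connected_component componentsI)
  have edge_F0: "open_edge e \<subseteq> F0"
    using components_maximal[OF F0(1) open_edge_endless(1)[OF e(1)]] open_edge z F0(3) by blast
  have "z \<in> ?C" using z c(3) by (auto simp: open_edge_def)
  then have "z \<in> closure (inside ?C)" "z \<in> closure (outside ?C)"
    using J(7,8) by (auto simp: frontier_def)
  then obtain a b where ab: "a \<in> F0" "a \<in> inside ?C" "b \<in> F0" "b \<in> outside ?C"
    using open_Int_closure_eq_empty[OF F0(2)] F0(3) by (metis IntI disjoint_iff)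
  define Fa where "Fa = connected_component_set (- ?X) a"
  define Fb where "Fb = connected_component_set (- ?X) b"
  have abX: "a \<in> - ?X" "b \<in> - ?X"
    using ab J(6) in_components_subset[OF F0(1)] unfolding c(3) X by blast+
  then have Fab: "Fa \<in> components (- ?X)" "Fb \<in> components (- ?X)" "a \<in> Fa" "b \<in> Fb"
    unfolding Fa_def Fb_def by (auto intro: componentsI)
  have "Fa \<noteq> Fb"
  proof
    assume "Fa = Fb"
    then have "b \<in> Fa" using Fab(4) by simp
    moreover have "Fa \<subseteq> inside ?C \<union> outside ?C"
      using in_components_subset[OF Fab(1)] CX J(6) by blast
    ultimately show False
      using connectedD[OF in_components_connected[OF Fab(1)] J(1,2)] J(5) ab Fab(3) by blast
  qed
  \<comment> \<open>No new face is among the surviving old ones.\<close>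
  have in_F0: "F = F0" if "F \<in> A" "F = Fa \<or> F = Fb" for F
    using that A(2) ab Fab components_eq[of F "- ?S" F0] F0(1) by blast
  let ?A' = "insert Fa (insert Fb (A - {F0}))"
  have "F \<in> components (- ?X)" if "F \<in> A - {F0}" for F
  proof (rule components_intermediate_subset)
    show F: "F \<in> components (- ?S)" using that A(2) by blast
    have "F \<inter> F0 = {}" using components_nonoverlap[OF F F0(1)] that by blast
    moreover have "pos ` e \<subseteq> ?S" using img_Int_drawn[OF e(1) B e(2)] by blast
    ultimately show "F \<subseteq> - ?X"
      using in_components_subset[OF F] edge_F0 unfolding X open_edge_def by blast
  qed (auto simp: X)
  then have "?A' \<subseteq> components (- ?X)" using Fab by blast
  moreover have "card A < card ?A'"
  proof -
    have "card ?A' = card (A - {F0}) + 2"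
      using A(1) \<open>Fa \<noteq> Fb\<close> in_F0 by (subst card_insert_disjoint; auto)+
    then show ?thesis using A(1) by (simp add: card_Diff_singleton_if split: if_splits)
  qed
  ultimately show thesis using A(1) by (intro that[of ?A']) auto
qed

text \<open>
  This is the inequality in Euler's formula that counts faces from below. A maximal acyclic edge set has
  at most $n - 1$ edges and at least one face, and each of the other edges creates at least one
  more face. Stating it with a finite set of faces avoids showing first that there are only finitely
  many.
\<close>
lemma many_faces:
  assumes "V \<noteq> {}"
  obtains A where "finite A" "A \<subseteq> components (- drawn E)" "card E + 2 \<le> card A + card V"
proof -
  define acyc where "acyc T \<longleftrightarrow> T \<subseteq> E \<and> (\<nexists>vs. cycle_in T vs)" for T
  have "acyc {}" by (auto simp: acyc_def cycle_in_def cycle_edges_def)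
  moreover have "finite (Collect acyc)"
    by (rule finite_subset[of _ "Pow E"]) (auto simp: acyc_def finite_E)
  ultimately obtain T where T: "acyc T" and max: "\<And>T'. acyc T' \<Longrightarrow> T \<subseteq> T' \<Longrightarrow> T' = T"
    using finite_has_maximal2[of "Collect acyc" "{}"] by auto
  have closing: "\<exists>vs. cycle_in (insert e T) vs \<and> e = {last vs, hd vs}" if e: "e \<in> E" "e \<notin> T" for e
  proof -
    have "\<not> acyc (insert e T)" using max[of "insert e T"] e by blast
    then obtain vs where vs: "cycle_in (insert e T) vs" using T e by (auto simp: acyc_def)
    have "e \<in> cycle_edges vs"
      using vs T unfolding acyc_def cycle_in_def by blast
    then show ?thesis using cycle_in_rotate[OF vs] by metis
  qed
  have TE: "T \<subseteq> E" using T by (simp add: acyc_def)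
  have "\<exists>A. finite A \<and> A \<subseteq> components (- drawn (T \<union> R)) \<and> card R < card A"
    if "finite R" "R \<subseteq> E - T" for R
    using that
  proof (induction R rule: finite_induct)
    case empty
    have "- drawn T \<noteq> {}"
      using compact_drawn[OF TE] compact_imp_bounded not_bounded_UNIV
      by (metis Compl_empty_eq double_compl)
    then obtain F where "F \<in> components (- drawn T)"
      using components_eq_empty by blast
    then show ?case by (intro exI[of _ "{F}"]) auto
  next
    case (insert e R)
    then obtain A where A: "finite A" "A \<subseteq> components (- drawn (T \<union> R))" "card R < card A"
      by auto
    obtain vs where vs: "cycle_in (insert e T) vs" "e = {last vs, hd vs}"
      using closing[of e] insert.prems by auto
    have "cycle_in (insert e (T \<union> R)) vs" by (rule cycle_in_mono[OF vs(1)]) auto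
    moreover have "T \<union> R \<subseteq> E" "e \<in> E" "e \<notin> T \<union> R" using insert TE by auto
    ultimately obtain A' where "finite A'" "A' \<subseteq> components (- drawn (insert e (T \<union> R)))"
        "card A < card A'"
      using add_closing_edge[of "T \<union> R" e vs A] vs(2) A(1,2) by metis
    then show ?case using A insert by (intro exI[of _ A']) auto
  qed
  from this[of "E - T"] obtain A where A: "finite A" "A \<subseteq> components (- drawn E)"
      "card (E - T) < card A"
    using finite_E TE by (auto simp: Un_absorb1)
  have "card T < card V"
    using assms T edge_subset card_edge finite_V by (intro acyclic_card) (auto simp: acyc_def)
  moreover have "card E = card (E - T) + card T"
    using TE finite_E by (metis add.commute card_Diff_subset card_mono finite_subset le_add_diff_inverse)
  ultimately show thesis using A that by auto
qed

text \<open>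
  The boundary of a face $F$ is contained in the drawing of the edges that $F$ touches. If these formed
  a forest, their complement would be connected, hence equal to $F$. Then nothing else could be drawn,
  and the whole graph would be that forest, although it contains a cycle.
\<close>
lemma face_touches_cycle:
  assumes F: "F \<in> components (- drawn E)" and cyc: "cycle_in E vs"
  obtains ws where "cycle_in {e \<in> E. touches F e} ws"
proof (rule ccontr)
  let ?B = "{e \<in> E. touches F e}"
  assume "\<not> thesis"
  then have conn: "connected (- drawn ?B)"
    using that by (intro connected_Compl_drawn_acyclic) auto
  have frontier: "frontier F \<subseteq> drawn ?B"
  proof
    fix x assume x: "x \<in> frontier F"
    have "closed (drawn E)" using compact_drawn compact_imp_closed by blast
    then have xE: "x \<in> drawn E" using frontier_of_components_closed_complement F x by blast
    show "x \<in> drawn ?B"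
    proof (cases "x \<in> pos ` V")
      case False
      then obtain e where e: "e \<in> E" "x \<in> img e" using xE by (auto simp: drawn_def)
      then have "x \<in> open_edge e"
        using False edge_subset[of e] by (auto simp: open_edge_def)
      moreover have "x \<in> closure F" using x by (simp add: frontier_def)
      ultimately show ?thesis using e by (auto simp: drawn_def touches_def)
    qed (simp add: drawn_def)
  qed
  have "drawn ?B \<subseteq> drawn E" by (auto simp: drawn_def)
  then have "- drawn ?B \<inter> F \<noteq> {}"
    using in_components_subset[OF F] in_components_nonempty[OF F] by blast
  then have "- drawn ?B \<subseteq> F"
    using connected_Int_frontier[OF conn, of F] frontier by blast
  then have "drawn E \<subseteq> drawn ?B" using in_components_subset[OF F] by blast
  have "e \<in> ?B" if "e \<in> E" for e
  proof (rule ccontr)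
    assume "e \<notin> ?B"
    then have "img e \<inter> drawn ?B = pos ` e" using img_Int_drawn[OF that, of ?B] by blast
    moreover have "img e \<subseteq> drawn E" using that by (auto simp: drawn_def)
    ultimately have "img e \<subseteq> pos ` e" using \<open>drawn E \<subseteq> drawn ?B\<close> by blast
    then show False using open_edge_endless(2)[OF that] unfolding open_edge_def by blast
  qed
  then have "cycle_in ?B vs" using cycle_in_mono[OF cyc] by blast
  with \<open>\<not> thesis\<close> that show False by blast
qed

text \<open>
  The incidences between faces and touched edges are counted only for edges on cycles (the set \<open>N\<close>):
  the bound of two faces per edge is available for these, and every face touches at least \<open>g\<close> of them.
\<close>
lemma girth_edge_bound:
  assumes "V \<noteq> {}" "2 \<le> g" and girth: "\<And>vs. cycle_in E vs \<Longrightarrow> g \<le> length vs"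
  shows "(g - 2) * card E \<le> g * (card V - 1)"
proof (cases "\<exists>vs. cycle_in E vs")
  case False
  then have "card E < card V"
    using assms(1) edge_subset card_edge finite_V by (intro acyclic_card) auto
  then show ?thesis by (intro mult_le_mono) auto
next
  case True
  then obtain vs where vs: "cycle_in E vs" by blast
  obtain A where A: "finite A" "A \<subseteq> components (- drawn E)" "card E + 2 \<le> card A + card V"
    using many_faces[OF assms(1)] .
  define N where "N = {e \<in> E. \<exists>ws. cycle_in E ws \<and> e \<in> cycle_edges ws}"
  have "finite N" using finite_E by (simp add: N_def)
  have "g * card A \<le> (\<Sum>F\<in>A. card {e \<in> N. touches F e})"
  proof -
    have "g \<le> card {e \<in> N. touches F e}" if FA: "F \<in> A" for F
    proof -
      obtain ws where ws: "cycle_in {e \<in> E. touches F e} ws"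
        by (rule face_touches_cycle[OF subsetD[OF A(2) FA] vs])
      then have "cycle_in E ws" using cycle_in_mono by blast
      then have "cycle_edges ws \<subseteq> {e \<in> N. touches F e}"
        using ws unfolding N_def cycle_in_def by blast
      then have "card (cycle_edges ws) \<le> card {e \<in> N. touches F e}"
        using \<open>finite N\<close> by (intro card_mono) auto
      moreover have "card (cycle_edges ws) = length ws"
        using ws card_cycle_edges by (auto simp: cycle_in_def)
      ultimately show ?thesis using girth[OF \<open>cycle_in E ws\<close>] by simp
    qed
    then show ?thesis using sum_bounded_below[of A g] by (simp add: mult.commute)
  qed
  also have "\<dots> = (\<Sum>e\<in>N. card {F \<in> A. touches F e})"
    using A(1) \<open>finite N\<close> by (intro sum_multicount_gen) auto
  also have "\<dots> \<le> (\<Sum>e\<in>N. 2)"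
  proof (rule sum_mono)
    fix e assume "e \<in> N"
    then obtain ws where "cycle_in E ws" "e \<in> cycle_edges ws" by (auto simp: N_def)
    then show "card {F \<in> A. touches F e} \<le> 2"
      using A by (intro touching_faces_le_2) auto
  qed
  also have "\<dots> \<le> 2 * card E"
    using card_mono[OF finite_E, of N] by (simp add: N_def)
  finally have "g * card A \<le> 2 * card E" .
  moreover have "g * (card E + 2) \<le> g * (card A + card V)" using A(3) by (rule mult_le_mono2)
  moreover have "1 \<le> card V" using assms(1) finite_V by (simp add: Suc_le_eq card_gt_0_iff)
  moreover obtain n where "card V = Suc n" using calculation(3) by (metis Suc_le_D One_nat_def)
  moreover obtain k where "g = k + 2" using assms(2) by (metis add.commute le_Suc_ex)
  ultimately show ?thesis by (simp add: algebra_simps)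
qed

end


section \<open>Planar graphs of given girth are sparse\<close>

text \<open>
  The closed directed walk of a vertex list, in the form in which the girth is defined: starting at the
  last vertex \<open>x\<close> of the list, it visits exactly the listed vertices.
\<close>
fun walk_arcs :: "'a \<Rightarrow> 'a list \<Rightarrow> ('a \<times> 'a) list" where
  "walk_arcs x [] = []"
| "walk_arcs x (y # ys) = (x, y) # walk_arcs y ys"

lemma length_walk_arcs [simp]: "length (walk_arcs x ys) = length ys"
  by (induction ys arbitrary: x) auto

lemma set_walk_arcs: "set (walk_arcs x ys) \<subseteq> {(u, v). {u, v} \<in> walk_edges (x # ys)}"
  by (induction ys arbitrary: x) auto

context pair_graph
begin

lemma awalk_walk_arcs:
  assumes "x \<in> pverts G" "set (walk_arcs x ys) \<subseteq> parcs G"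
  shows "awalk x (walk_arcs x ys) (last (x # ys))" "awalk_verts x (walk_arcs x ys) = x # ys"
proof -
  have "cas x (walk_arcs x ys) (last (x # ys))"
    by (induction ys arbitrary: x) auto
  with assms show "awalk x (walk_arcs x ys) (last (x # ys))"
    by (simp add: awalk_def)
  show "awalk_verts x (walk_arcs x ys) = x # ys"
    by (induction ys arbitrary: x) auto
qed

lemma girth_le_cycle_length:
  assumes E: "\<And>u v. {u, v} \<in> E \<Longrightarrow> (u, v) \<in> parcs G" and vs: "cycle_in E vs"
  shows "girth G \<le> enat (length vs)"
proof -
  from vs have "vs \<noteq> []" by (auto simp: cycle_in_def)
  let ?c = "walk_arcs (last vs) vs"
  have edges: "walk_edges (last vs # vs) \<subseteq> E"
    using vs \<open>vs \<noteq> []\<close> by (simp add: cycle_in_def cycle_edges_def walk_edges_Cons)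
  then have arcs: "set ?c \<subseteq> parcs G" using set_walk_arcs[of "last vs" vs] E by fastforce
  have "(last vs, hd vs) \<in> parcs G" using vs E by (simp add: cycle_in_def cycle_edges_def)
  then have "last vs \<in> pverts G" using arc_fst_in_verts by fastforce
  from awalk_walk_arcs[OF this arcs] have "cycle ?c"
    using vs \<open>vs \<noteq> []\<close> unfolding cycle_def
    by (intro exI[of _ "last vs"]) (auto simp: cycle_in_def neq_Nil_conv)
  then have "?c \<in> {c. cycle c \<and> 3 \<le> length c}" using vs by (simp add: cycle_in_def)
  then have "girth G \<le> enat (length ?c)" unfolding girth_def by (rule INF_lower)
  then show ?thesis by simp
qed

end

text \<open>
  Each unordered pair comes from exactly two ordered ones.
\<close>
lemma card_symmetric_relation:
  assumes "finite R" "sym R" "irrefl R"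
  shows "card R = 2 * card ((\<lambda>(u, v). {u, v}) ` R)"
proof -
  define f where "f = (\<lambda>(u :: 'a, v). {u, v})"
  have "card {r \<in> R. f r = e} = 2" if "e \<in> f ` R" for e
  proof -
    from that obtain u v where uv: "(u, v) \<in> R" "e = {u, v}" by (auto simp: f_def)
    then have "{r \<in> R. f r = e} = {(u, v), (v, u)}"
      using symD[OF assms(2)] by (auto simp: f_def doubleton_eq_iff)
    moreover have "u \<noteq> v" using uv assms(3) by (auto simp: irrefl_def)
    ultimately show ?thesis by simp
  qed
  then have "(\<Sum>r\<in>R. card {e \<in> f ` R. f r = e}) = 2 * card (f ` R)"
    using assms(1) by (intro sum_multicount) auto
  moreover have "{e \<in> f ` R. f r = e} = {f r}" if "r \<in> R" for r
    using that by blast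
  ultimately show ?thesis by (simp add: f_def)
qed

text \<open>
  The bound for an arbitrary subgraph, with vertex set \<open>U\<close> and arc set \<open>R\<close>; the factor 2 accounts
  for counting arcs. A drawing of the graph restricts to one of the subgraph, and cycles of the
  subgraph are cycles of the graph.
\<close>
lemma planar_girth_sparse:
  assumes G: "pair_graph G" "planar G" and g: "2 \<le> g" "enat g \<le> girth G"
    and U: "U \<subseteq> pverts G" "U \<noteq> {}" and R: "R \<subseteq> parcs G" "R \<subseteq> U \<times> U" "sym R"
  shows "(g - 2) * card R \<le> 2 * (g * (card U - 1))"
proof -
  interpret pair_graph G by fact
  define E where "E = (\<lambda>(u, v). {u, v}) ` R"
  obtain pos crv where draw: "plane_drawing G pos crv" using G(2) by (auto simp: planar_def)
  have E: "(u, v) \<in> parcs G" if "{u, v} \<in> E" for u v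
    using that symD[OF R(3)] subsetD[OF R(1)] by (auto simp: E_def doubleton_eq_iff)
  have "finite U" using U(1) pair_finite_verts finite_subset by blast
  have plane: "plane_graph U E pos crv"
  proof
    show "finite U" by fact
    show "inj_on pos U" using draw U(1) by (auto simp: plane_drawing_def intro: inj_on_subset)
    fix e assume "e \<in> E"
    then obtain u v where e: "(u, v) \<in> R" "e = {u, v}" by (auto simp: E_def)
    then have uv: "(u, v) \<in> parcs G" using R(1) by blast
    then show "card e = 2" using e(2) no_loops' by (auto simp: card_2_iff)
    show "e \<subseteq> U" using e R(2) by auto
    have *: "Path_Connected.arc (crv {u, v})" "{pathstart (crv {u, v}), pathfinish (crv {u, v})} = {pos u, pos v}"
      "path_image (crv {u, v}) \<inter> pos ` pverts G = {pos u, pos v}"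
      using draw uv unfolding plane_drawing_def by blast+
    show "Path_Connected.arc (crv e)" "{pathstart (crv e), pathfinish (crv e)} = pos ` e"
      using * e(2) by simp_all
    show "path_image (crv e) \<inter> pos ` U = pos ` e"
      using *(3) \<open>e \<subseteq> U\<close> U(1) unfolding e(2) by blast
    fix f assume "f \<in> E" "e \<noteq> f"
    then obtain x y where f: "(x, y) \<in> R" "f = {x, y}" by (auto simp: E_def)
    then have "(x, y) \<in> parcs G" using R(1) by blast
    with draw uv \<open>e \<noteq> f\<close> show "path_image (crv e) \<inter> path_image (crv f) \<subseteq> pos ` (e \<inter> f)"
      unfolding plane_drawing_def e(2) f(2) by blast
  qed
  have "(g - 2) * card E \<le> g * (card U - 1)"
  proof (rule plane_graph.girth_edge_bound[OF plane U(2) g(1)])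
    fix vs assume "cycle_in E vs"
    then have "girth G \<le> enat (length vs)"
      using girth_le_cycle_length[of E vs] E by blast
    with g(2) have "enat g \<le> enat (length vs)" by (rule order_trans)
    then show "g \<le> length vs" by simp
  qed
  moreover have "card R = 2 * card E"
    unfolding E_def
  proof (rule card_symmetric_relation)
    show "finite R" using R(1) pair_finite_arcs finite_subset by blast
    show "irrefl R" using R(1) no_loops' by (auto simp: irrefl_def)
  qed (rule R(3))
  ultimately show ?thesis by simp
qed


section \<open>Orderings of sparse graphs\<close>

text \<open>
  An ordering found from its end: in each step a vertex \<open>u\<close> of the remaining set \<open>W\<close> becomes the
  largest element of \<open>W\<close>, so that its predecessors are exactly \<open>W - {u}\<close>.
\<close>
lemma elimination_ordering:
  assumes "finite V" "Inv V"
    and step: "\<And>W. W \<subseteq> V \<Longrightarrow> W \<noteq> {} \<Longrightarrow> Inv W \<Longrightarrow> \<exists>u\<in>W. P u (W - {u}) \<and> Inv (W - {u})"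
  shows "\<exists>r. r \<subseteq> V \<times> V \<and> strict_linear_order_on V r \<and> (\<forall>u\<in>V. P u {x. (x, u) \<in> r})"
proof -
  have "W \<subseteq> V \<longrightarrow> Inv W \<longrightarrow>
      (\<exists>r. r \<subseteq> W \<times> W \<and> strict_linear_order_on W r \<and> (\<forall>u\<in>W. P u {x. (x, u) \<in> r}))"
    if "finite W" for W
    using that
  proof (induction W rule: finite_psubset_induct)
    case (psubset W)
    show ?case
    proof (cases "W = {}")
      case True
      then show ?thesis
        by (auto simp: strict_linear_order_on_def trans_def irrefl_def total_on_def)
    next
      case False
      show ?thesis
      proof (intro impI)
        assume W: "W \<subseteq> V" "Inv W"
        from step[OF W(1) False W(2)] obtain u where u: "u \<in> W" "P u (W - {u})" "Inv (W - {u})"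
          by blast
        with psubset.IH[of "W - {u}"] W obtain r where r: "r \<subseteq> (W - {u}) \<times> (W - {u})"
            "strict_linear_order_on (W - {u}) r" "\<forall>v\<in>W - {u}. P v {x. (x, v) \<in> r}"
          by blast
        let ?r = "r \<union> (W - {u}) \<times> {u}"
        have "{x. (x, v) \<in> ?r} = (if v = u then W - {u} else {x. (x, v) \<in> r})" for v
          using r(1) by auto
        then have "\<forall>v\<in>W. P v {x. (x, v) \<in> ?r}" using r(3) u(2) by auto
        moreover have "trans ?r"
          using r(1,2) unfolding strict_linear_order_on_def trans_def by blast
        moreover have "irrefl ?r" "total_on W ?r"
          using r(2) unfolding strict_linear_order_on_def irrefl_def total_on_def by blast+
        moreover have "?r \<subseteq> W \<times> W" using r(1) u(1) by blast
        ultimately show "\<exists>r. r \<subseteq> W \<times> W \<and> strict_linear_order_on W r \<and> (\<forall>u\<in>W. P u {x. (x, u) \<in> r})"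
          unfolding strict_linear_order_on_def by blast
      qed
    qed
  qed
  with assms show ?thesis by blast
qed

text \<open>
  Every vertex \<open>v\<close> outside \<open>W\<close> with $r \<ge> 2$ neighbours in \<open>W\<close> gives weight \<open>w r\<close> to each of them.
  Together these weights are at most $r - \<alpha>$, the amount by which the edges at \<open>v\<close> exceed the share
  \<open>\<alpha>\<close> that sparsity grants to the vertex \<open>v\<close>. So the total of half the degrees within \<open>W\<close> and the
  received weights stays below \<open>\<alpha>\<close> per vertex of \<open>W\<close>.
\<close>
lemma exists_light_vertex:
  fixes N :: "'a \<Rightarrow> 'a set" and \<alpha> \<rho> :: real and w :: "nat \<Rightarrow> real"
  assumes "finite V" "W \<subseteq> V" "W \<noteq> {}"
    and N: "\<And>u v. v \<in> N u \<longleftrightarrow> u \<in> N v"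
    and sparse: "\<And>U R. U \<subseteq> V \<Longrightarrow> U \<noteq> {} \<Longrightarrow> R \<subseteq> U \<times> U \<Longrightarrow> R \<subseteq> {(u, v). v \<in> N u} \<Longrightarrow> sym R \<Longrightarrow>
      real (card R) < 2 * \<alpha> * card U"
    and w: "w 0 = 0" "w 1 = 0"
      "\<And>v. v \<in> V - W \<Longrightarrow> 2 \<le> card (N v \<inter> W) \<Longrightarrow>
        card (N v \<inter> W) * w (card (N v \<inter> W)) \<le> card (N v \<inter> W) - \<alpha>"
  shows "\<exists>u\<in>W. card (N u \<inter> W) / 2 + (\<Sum>v\<in>{v \<in> V - W. u \<in> N v}. w (card (N v \<inter> W))) < \<alpha>"
proof (rule ccontr)
  assume contra: "\<not> ?thesis"
  define d where "d v = card (N v \<inter> W)" for v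
  define M where "M = {v \<in> V - W. 2 \<le> d v}"
  have fin: "finite W" "finite (V - W)" "finite M" "\<And>v. finite (N v \<inter> W)"
    using assms(1,2) finite_subset by (auto simp: M_def)
  \<comment> \<open>The arcs within \<open>W\<close>, and the arcs between \<open>W\<close> and \<open>M\<close> in both directions.\<close>
  let ?W = "SIGMA u:W. N u \<inter> W" and ?M = "SIGMA v:M. N v \<inter> W"
  let ?R = "?W \<union> (?M \<union> ?M\<inverse>)"
  have "\<alpha> * card W = (\<Sum>u\<in>W. \<alpha>)" by simp
  also have "\<dots> \<le> (\<Sum>u\<in>W. d u / 2 + (\<Sum>v\<in>{v \<in> V - W. u \<in> N v}. w (d v)))"
    using contra by (intro sum_mono) (auto simp: d_def not_less)
  also have "\<dots> = (\<Sum>u\<in>W. d u / 2) + (\<Sum>v\<in>V - W. \<Sum>u\<in>{u \<in> W. u \<in> N v}. w (d v))"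
    unfolding sum.distrib by (subst sum.swap_restrict[OF fin(1,2)]) (rule refl)
  also have "(\<Sum>v\<in>V - W. \<Sum>u\<in>{u \<in> W. u \<in> N v}. w (d v)) = (\<Sum>v\<in>V - W. d v * w (d v))"
    by (intro sum.cong) (auto simp: d_def Int_def conj_commute)
  also have "\<dots> = (\<Sum>v\<in>M. d v * w (d v))"
  proof (rule sum.mono_neutral_right)
    show "\<forall>v\<in>V - W - M. d v * w (d v) = 0"
    proof
      fix v assume "v \<in> V - W - M"
      then have "d v = 0 \<or> d v = 1" by (auto simp: M_def)
      then show "d v * w (d v) = 0" using w(1,2) by auto
    qed
  qed (auto simp: M_def assms(1))
  also have "\<dots> \<le> (\<Sum>v\<in>M. d v - \<alpha>)"
    using w(3) by (intro sum_mono) (auto simp: M_def d_def)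
  also have "\<dots> = (\<Sum>v\<in>M. real (d v)) - \<alpha> * card M"
    by (simp add: sum_subtractf)
  also have "(\<Sum>u\<in>W. d u / 2) + ((\<Sum>v\<in>M. real (d v)) - \<alpha> * card M)
    = card ?R / 2 - \<alpha> * card M"
  proof -
    have disj: "?W \<inter> (?M \<union> ?M\<inverse>) = {}" "?M \<inter> ?M\<inverse> = {}"
      by (auto simp: M_def)
    have "finite ?W" "finite ?M" using fin by (auto intro: finite_SigmaI)
    then have "card ?R = card ?W + (card ?M + card ?M)"
      using disj by (simp add: card_Un_disjoint)
    also have "\<dots> = (\<Sum>u\<in>W. d u) + 2 * (\<Sum>v\<in>M. d v)"
      using fin by (simp add: card_SigmaI d_def)
    finally show ?thesis by (simp add: sum_divide_distrib[symmetric])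
  qed
  also have "\<dots> < (2 * \<alpha> * card (W \<union> M)) / 2 - \<alpha> * card M"
  proof -
    have "sym ?R" using N by (auto simp: sym_def)
    then have "real (card ?R) < 2 * \<alpha> * card (W \<union> M)"
      using assms(2,3) N by (intro sparse) (auto simp: M_def)
    then show ?thesis by simp
  qed
  also have "\<dots> = \<alpha> * card W"
    using fin by (subst card_Un_disjoint) (auto simp: M_def algebra_simps)
  finally show False by simp
qed

text \<open>
  The empty set belongs to all the power sets but is counted once; this is the reason for the $-1$ in
  the definition of $\<rho>_g$.
\<close>
lemma card_Union_Pow_le:
  assumes "finite I" "\<And>i. i \<in> I \<Longrightarrow> finite (A i)"
  shows "card (\<Union>i\<in>I. Pow (A i)) \<le> 1 + (\<Sum>i\<in>I. 2 ^ card (A i) - 1)"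
proof -
  have "card (\<Union>i\<in>I. Pow (A i)) \<le> card (insert {} (\<Union>i\<in>I. Pow (A i) - {{}}))"
    using assms by (intro card_mono) auto
  also have "\<dots> \<le> 1 + card (\<Union>i\<in>I. Pow (A i) - {{}})"
    by (rule card_insert_le_m1) simp_all
  also have "\<dots> \<le> 1 + (\<Sum>i\<in>I. card (Pow (A i) - {{}}))"
    by (rule add_left_mono[OF card_UN_le[OF assms(1)]])
  also have "\<dots> = 1 + (\<Sum>i\<in>I. 2 ^ card (A i) - 1)"
    using assms by (auto simp: card_Pow card_Diff_singleton intro!: sum.cong)
  finally show ?thesis .
qed

lemma girth_parameters:
  assumes "5 \<le> g"
  shows "1 < alpha_of g" "alpha_of g < 2" "2 \<le> D_of g" "of_int q < 2 * alpha_of g \<Longrightarrow> q \<le> D_of g"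
    "0 < rho_of g"
    "2 \<le> r \<Longrightarrow> int r \<le> D_of g \<Longrightarrow> (2 ^ (r - 1) - 1) / (1 - alpha_of g / r) \<le> rho_of g"
proof -
  show a: "1 < alpha_of g" "alpha_of g < 2" using assms by (auto simp: alpha_of_def field_simps)
  show D: "2 \<le> D_of g" using a by (simp add: D_of_def le_ceiling_iff)
  show "q \<le> D_of g" if "of_int q < 2 * alpha_of g"
  proof -
    have "q < \<lceil>2 * alpha_of g\<rceil>" using that by (simp add: less_ceiling_iff)
    then show ?thesis by (simp add: D_of_def)
  qed
  have rho: "(2 ^ (r - 1) - 1) / (1 - alpha_of g / r) \<le> rho_of g"
    if "2 \<le> r" "int r \<le> D_of g" for r
  proof -
    have "(2 ^ nat (int r - 1) - 1) / (1 - alpha_of g / of_int (int r)) \<le> rho_of g"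
      unfolding rho_of_def using that
      by (intro Max_ge finite_imageI image_eqI[where x = "int r"]) simp_all
    moreover have "nat (int r - 1) = r - 1" by simp
    ultimately show ?thesis by simp
  qed
  from rho[of 2] D have "1 / (1 - alpha_of g / 2) \<le> rho_of g" by simp
  moreover have "0 < 1 / (1 - alpha_of g / 2)" using a by simp
  ultimately show "0 < rho_of g" by linarith
  show "2 \<le> r \<Longrightarrow> int r \<le> D_of g \<Longrightarrow> (2 ^ (r - 1) - 1) / (1 - alpha_of g / r) \<le> rho_of g"
    by (rule rho)
qed

text \<open>
  The strict inequality for the logarithm comes from rounding: $\log_2 s$ is less than
  $\<lfloor>\log_2 C_g(q)\<rfloor> + 1$.
\<close>
lemma T_of_bound:
  assumes "0 \<le> q" "q \<le> D_of g" "1 \<le> s" "int s \<le> C_of g q"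
  shows "of_int q + log 2 s < of_int (T_of g)" "q < T_of g"
proof -
  let ?k = "\<lfloor>log 2 (of_int (C_of g q))\<rfloor>"
  have T: "q + 1 + ?k \<le> T_of g"
    unfolding T_of_def using assms(1,2) by (intro Max_ge) auto
  have s: "0 < real s" "real s \<le> of_int (C_of g q)" using assms(3,4) by linarith+
  then have "log 2 s \<le> log 2 (of_int (C_of g q))" by simp
  also have "\<dots> < of_int ?k + 1" by linarith
  finally have "of_int q + log 2 s < of_int (q + 1 + ?k)" by simp
  also have "\<dots> \<le> of_int (T_of g)" using T by linarith
  finally show *: "of_int q + log 2 s < of_int (T_of g)" .
  have "0 \<le> log 2 s" using assms(3) by simp
  with * show "q < T_of g" by linarith
qed

theorem theorem4p3:
  fixes G :: "'a pair_pre_digraph" and g :: nat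
  assumes "5 \<le> g"
    and "pair_graph G"
    and "planar G"
    and "enat g \<le> girth G"
  shows "strongly_degenerate (T_of g) G"
proof -
  interpret pair_graph G by fact
  let ?V = "pverts G" and ?N = "nbhd G" and ?\<alpha> = "alpha_of g" and ?\<rho> = "rho_of g"
  note par = girth_parameters[OF assms(1)]
  have N: "v \<in> ?N u \<longleftrightarrow> u \<in> ?N v" "u \<notin> ?N u" "?N u \<subseteq> ?V" for u v
    using arcs_symmetric no_loops' arc_snd_in_verts by (force simp: nbhd_def)+
  have sparse: "real (card R) < 2 * ?\<alpha> * card U"
    if "U \<subseteq> ?V" "U \<noteq> {}" "R \<subseteq> U \<times> U" "R \<subseteq> {(u, v). v \<in> ?N u}" "sym R" for U R
  proof -
    have "(g - 2) * card R \<le> 2 * (g * (card U - 1))"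
      using that assms by (intro planar_girth_sparse[of G]) (auto simp: nbhd_def)
    moreover have "0 < card U" using that pair_finite_verts by (auto simp: card_gt_0_iff finite_subset)
    then have "2 * (g * (card U - 1)) < 2 * (g * card U)" using assms(1) by simp
    ultimately have "(g - 2) * card R < 2 * (g * card U)" by (rule le_less_trans)
    then have "real ((g - 2) * card R) < real (2 * (g * card U))" by (subst of_nat_less_iff)
    then have "(real g - 2) * card R < 2 * (real g * card U)"
      using assms(1) by (simp add: of_nat_diff)
    then show ?thesis using assms(1) by (simp add: alpha_of_def field_simps)
  qed
  \<comment> \<open>\<open>good u B\<close> is the condition on \<open>u\<close> when \<open>B\<close> is the set of all vertices preceding it.\<close>
  define good where "good u B \<longleftrightarrow>
      (?N u - B \<noteq> {} \<longrightarrow> card (?N u \<inter> B) +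
        log 2 (card {Y. Y \<subseteq> ?V \<and> (\<exists>v\<in>?N u - B. Y \<subseteq> ?N v \<inter> B)}) < of_int (T_of g)) \<and>
      (?N u - B = {} \<longrightarrow> int (card (?N u \<inter> B)) \<le> T_of g)" for u B
  define Inv where "Inv W \<longleftrightarrow> (\<forall>v\<in>?V - W. int (card (?N v \<inter> W)) \<le> D_of g)" for W
  have "\<exists>u\<in>W. good u (W - {u}) \<and> Inv (W - {u})" if W: "W \<subseteq> ?V" "W \<noteq> {}" "Inv W" for W
  proof -
    \<comment> \<open>As \<open>u\<close> itself is one of the \<open>r\<close> neighbours, \<open>r - 1\<close> of them precede \<open>u\<close>.\<close>
    define w where "w r = (2 ^ (r - 1) - 1) / ?\<rho>" for r :: nat
    have "\<exists>u\<in>W. card (?N u \<inter> W) / 2 + (\<Sum>v\<in>{v \<in> ?V - W. u \<in> ?N v}. w (card (?N v \<inter> W))) < ?\<alpha>"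
    proof (rule exists_light_vertex[OF pair_finite_verts W(1,2) N(1) sparse])
      fix v assume v: "v \<in> ?V - W" "2 \<le> card (?N v \<inter> W)"
      let ?r = "card (?N v \<inter> W)"
      have "(2 ^ (?r - 1) - 1) / (1 - ?\<alpha> / ?r) \<le> ?\<rho>"
        using v W(3) by (intro par(6)) (auto simp: Inv_def)
      moreover have "0 < 1 - ?\<alpha> / ?r" using v(2) par(2) by simp
      ultimately have "2 ^ (?r - 1) - 1 \<le> (1 - ?\<alpha> / ?r) * ?\<rho>"
        by (simp add: pos_divide_le_eq mult.commute)
      then have "w ?r \<le> 1 - ?\<alpha> / ?r" using par(5) by (simp add: w_def pos_divide_le_eq)
      then have "?r * w ?r \<le> ?r * (1 - ?\<alpha> / ?r)" by (intro mult_left_mono) auto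
      also have "\<dots> = ?r - ?\<alpha>" using v(2) by (simp add: algebra_simps)
      finally show "?r * w ?r \<le> ?r - ?\<alpha>" .
    qed (auto simp: w_def)
    then obtain u where u: "u \<in> W"
      "card (?N u \<inter> W) / 2 + (\<Sum>v\<in>{v \<in> ?V - W. u \<in> ?N v}. w (card (?N v \<inter> W))) < ?\<alpha>"
      by blast
    define q where "q = card (?N u \<inter> W)"
    let ?B = "W - {u}" and ?L = "?N u - W"
    have NB: "?N u \<inter> ?B = ?N u \<inter> W" "?N u - ?B = ?L" using N(2) by blast+
    have L: "{v \<in> ?V - W. u \<in> ?N v} = ?L" using N(1,3) by blast
    have finL: "finite ?L" using N(3) pair_finite_verts finite_subset by blast
    \<comment> \<open>An upper bound for the number of nonempty sets in \<open>trace_sets\<close>.\<close>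
    define s where "s = (\<Sum>v\<in>?L. 2 ^ card (?N v \<inter> ?B) - 1 :: nat)"
    have "card (?N v \<inter> ?B) = card (?N v \<inter> W) - 1" if "v \<in> ?L" for v
    proof -
      have "?N v \<inter> ?B = ?N v \<inter> W - {u}" "u \<in> ?N v \<inter> W" using that N(1) u(1) by blast+
      then show ?thesis by simp
    qed
    then have "real s / ?\<rho> = (\<Sum>v\<in>?L. w (card (?N v \<inter> W)))"
      by (simp add: s_def w_def sum_divide_distrib of_nat_diff)
    with u(2) have qs: "q / 2 + real s / ?\<rho> < ?\<alpha>" by (simp only: q_def L)
    have "0 \<le> real s / ?\<rho>" using par(5) by simp
    with qs have "real q < 2 * ?\<alpha>" by linarith
    then have qD: "int q \<le> D_of g" by (intro par(4)) simp
    have "real s < ?\<rho> * (?\<alpha> - q / 2)"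
      using qs par(5) by (simp add: field_simps)
    then have "int s < C_of g (int q)" by (simp add: C_of_def less_ceiling_iff)
    then have sC: "int (s + 1) \<le> C_of g (int q)" by simp
    have "good u ?B"
      unfolding good_def NB
    proof (intro conjI impI)
      show "int (card (?N u \<inter> W)) \<le> T_of g"
        using T_of_bound(2)[OF _ qD _ sC] by (simp add: q_def)
      assume "?L \<noteq> {}"
      let ?S = "{Y. Y \<subseteq> ?V \<and> (\<exists>v\<in>?L. Y \<subseteq> ?N v \<inter> ?B)}"
      have S: "?S = (\<Union>v\<in>?L. Pow (?N v \<inter> ?B))" using N(3) by blast
      have fin: "finite (?N v \<inter> ?B)" for v using N(3) pair_finite_verts finite_subset by blast
      have "card ?S \<le> 1 + s"
        unfolding S s_def using finL fin by (intro card_Union_Pow_le) auto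
      moreover have "{} \<in> ?S" using \<open>?L \<noteq> {}\<close> by auto
      moreover have "finite ?S" using pair_finite_verts by simp
      ultimately have "1 \<le> card ?S" "int (card ?S) \<le> C_of g (int q)"
        using sC by (auto simp: Suc_le_eq card_gt_0_iff)
      then show "card (?N u \<inter> W) + log 2 (card ?S) < of_int (T_of g)"
        using T_of_bound(1)[OF _ qD] by (simp add: q_def)
    qed
    moreover have "Inv ?B"
      unfolding Inv_def
    proof
      fix v assume "v \<in> ?V - ?B"
      then consider "v = u" | "v \<in> ?V - W" by blast
      then show "int (card (?N v \<inter> ?B)) \<le> D_of g"
      proof cases
        case 1
        then show ?thesis using NB(1) qD by (simp add: q_def)
      next
        case 2
        have "card (?N v \<inter> ?B) \<le> card (?N v \<inter> W)"
          using N(3) pair_finite_verts finite_subset by (intro card_mono) blast+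
        moreover have "int (card (?N v \<inter> W)) \<le> D_of g" using 2 W(3) by (simp add: Inv_def)
        ultimately show ?thesis by linarith
      qed
    qed
    ultimately show ?thesis using u(1) by blast
  qed
  moreover have "Inv ?V" by (simp add: Inv_def)
  ultimately obtain r where r: "r \<subseteq> ?V \<times> ?V" "strict_linear_order_on ?V r"
      "\<forall>u\<in>?V. good u {x. (x, u) \<in> r}"
    using elimination_ordering[OF pair_finite_verts, of Inv good] by blast
  have "strong_ordering (T_of g) G r"
    unfolding strong_ordering_def
  proof (intro conjI ballI r(2))
    fix u assume "u \<in> ?V"
    let ?B = "{x. (x, u) \<in> r}"
    have less: "nbhd_less G r u = ?N u \<inter> ?B" by (auto simp: nbhd_less_def)
    have "(u, x) \<in> r \<longleftrightarrow> (x, u) \<notin> r" if "x \<in> ?N u" for x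
    proof -
      have "x \<in> ?V" "x \<noteq> u" using that N(2,3) by blast+
      with r(2) \<open>u \<in> ?V\<close> show ?thesis
        unfolding strict_linear_order_on_def irrefl_def trans_def total_on_def by blast
    qed
    then have greater: "nbhd_greater G r u = ?N u - ?B" by (auto simp: nbhd_greater_def)
    have traces: "trace_sets G r u = {Y. Y \<subseteq> ?V \<and> (\<exists>v\<in>?N u - ?B. Y \<subseteq> ?N v \<inter> ?B)}"
      unfolding trace_sets_def greater by (auto simp: nbhd_before_def)
    have "good u ?B" using r(3) \<open>u \<in> ?V\<close> by blast
    then show "nbhd_greater G r u \<noteq> {} \<longrightarrow> real (card (nbhd_less G r u)) +
        log 2 (real (card (trace_sets G r u))) < of_int (T_of g)"
      and "nbhd_greater G r u = {} \<longrightarrow> int (card (nbhd_less G r u)) \<le> T_of g"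
      unfolding good_def less greater traces by blast+
  qed
  then show ?thesis by (auto simp: strongly_degenerate_def)
qed

end
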